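(* Let $Z(x,\hbar)=\exp\Big[\sum_{g\ge0}\sum_{n\ge1}\frac{\hbar^{2g-2+n}}{n!}F_{g,n}(x,x,\ldots,x)\Big]$, a formal series in $x$ and $\hbar$ (more precisely in $\mathbb{Q}[[x\hbar^{-1},\hbar]]$). Then, with $\widehat x=x$ and $\widehat y=-\hbar\frac{\partial}{\partial x}$, \[ [\widehat x\,\widehat y^{\,2}+\widehat y+1]\,Z(x,\hbar)=0,\quad\text{i.e.}\quad \Big[x\hbar^2\frac{\partial^2}{\partial x^2}-\hbar\frac{\partial}{\partial x}+1\Big]Z(x,\hbar)=0. \]
   Context: Monotone Hurwitz numbers: for $g\ge0$, $n\ge1$ and positive integers $\mu_1,\ldots,\mu_n$ with $|\boldsymbol\mu|=\mu_1+\cdots+\mu_n$, let $m=2g-2+n+|\boldsymbol\mu|$. The monotone Hurwitz number $\vec H_{g,n}(\mu_1,\ldots,\mu_n)$ is $\frac{1}{|\boldsymbol\mu|!}$ times the number of $m$-tuples $(\sigma_1,\ldots,\sigma_m)$ of transpositions in $S_{|\boldsymbol\mu|}$, together with a labelling of the cycles of $\sigma_1\circ\cdots\circ\sigma_m$ by $1,\ldots,n$, such that cycle $i$ has length $\mu_i$; the $\sigma_j$ generate a transitive subgroup; and writing $\sigma_j=(a_j\,b_j)$ with $a_j<b_j$, $b_1\le\cdots\le b_m$ (zero if $m<0$). The free energy is $F_{g,n}(x_1,\ldots,x_n)=\sum_{\mu_i\ge1}\vec H_{g,n}(\boldsymbol\mu)x_1^{\mu_1}\cdots x_n^{\mu_n}$;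 $F_{g,n}(x,\ldots,x)$ denotes setting all variables equal to $x$. *)

theory Defs
  imports "HOL-Computational_Algebra.Formal_Laurent_Series" "HOL-Combinatorics.Transposition"
          "HOL-Library.FuncSet"
begin

inductive_set gen_perms :: "(nat \<Rightarrow> nat) set \<Rightarrow> (nat \<Rightarrow> nat) set" for S where
  id_in: "id \<in> gen_perms S"
| gen: "s \<in> S \<Longrightarrow> p \<in> gen_perms S \<Longrightarrow> s \<circ> p \<in> gen_perms S"
| gen_inv: "s \<in> S \<Longrightarrow> p \<in> gen_perms S \<Longrightarrow> inv s \<circ> p \<in> gen_perms S"

definition tuple_perm :: "(nat \<times> nat) list \<Rightarrow> nat \<Rightarrow> nat" where
  "tuple_perm ts = foldr (\<lambda>(a, b) f. transpose a b \<circ> f) ts id"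

definition cycle_of :: "(nat \<Rightarrow> nat) \<Rightarrow> nat \<Rightarrow> nat set" where
  "cycle_of \<sigma> k = {(\<sigma> ^^ j) k | j. True}"

text \<open>Valid tuples of transpositions in S_d (acting on {1..d}) with m entries,
  together with a labelling L of the cycles of the product by 1..n (L assigns to
  each point the label of its cycle), such that cycle i has length mu_i.\<close>
definition monotone_tuples :: "nat \<Rightarrow> nat list \<Rightarrow> ((nat \<times> nat) list \<times> (nat \<Rightarrow> nat)) set" where
  "monotone_tuples m \<mu> =
    (let d = sum_list \<mu>; n = length \<mu> in
     {(ts, L). length ts = m
        \<and> (\<forall>(a, b) \<in> set ts. 1 \<le> a \<and> a < b \<and> b \<le> d)
        \<and> sorted (map snd ts)
        \<and> (\<forall>i\<in>{1..d}. \<forall>j\<in>{1..d}. \<exists>p \<in> gen_perms ((\<lambda>(a, b). transpose a b) ` set ts). p i = j)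
        \<and> L \<in> {1..d} \<rightarrow>\<^sub>E {1..n}
        \<and> (\<forall>i\<in>{1..n}. \<exists>k\<in>{1..d}. {c\<in>{1..d}. L c = i} = cycle_of (tuple_perm ts) k
                                  \<and> card (cycle_of (tuple_perm ts) k) = \<mu> ! (i - 1))})"

definition monotone_hurwitz :: "nat \<Rightarrow> nat list \<Rightarrow> rat" where
  "monotone_hurwitz g \<mu> =
    (let m = 2 * int g - 2 + int (length \<mu>) + int (sum_list \<mu>) in
     if m < 0 then 0
     else of_nat (card (monotone_tuples (nat m) \<mu>)) / of_nat (fact (sum_list \<mu>)))"

definition free_energy_diag_coeff :: "nat \<Rightarrow> nat \<Rightarrow> nat \<Rightarrow> rat" where
  "free_energy_diag_coeff g n d =
     (\<Sum>\<mu> \<in> {\<mu>. length \<mu> = n \<and> (\<forall>k\<in>set \<mu>. 1 \<le> k) \<and> sum_list \<mu> = d}. monotone_hurwitz g \<mu>)"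

text \<open>For fixed d: the power series in hbar
  sum_{g >= 0, 1 <= n <= d} hbar^(2g-1+n) / n! * [x^d] F_{g,n}(x,...,x),
  which is hbar times the coefficient of x^d of the exponent.\<close>
definition exponent_coeff_shifted :: "nat \<Rightarrow> rat fps" where
  "exponent_coeff_shifted d = Abs_fps (\<lambda>j.
      \<Sum>n\<in>{1..d}. \<Sum>g\<in>{g. 2 * g + n - 1 = j}. free_energy_diag_coeff g n d / of_nat (fact n))"

text \<open>The exponent  sum_{g,n} hbar^(2g-2+n)/n! F_{g,n}(x,...,x)  as a power series in x
  with coefficients Laurent series in hbar (Q((hbar))[[x]]).\<close>
definition free_energy_sum :: "rat fls fps" where
  "free_energy_sum = Abs_fps (\<lambda>d. fls_X_inv * fps_to_fls (exponent_coeff_shifted d))"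

text \<open>Partition function Z = exp(free_energy_sum); the exponent has zero constant term.\<close>
definition partition_function :: "rat fls fps" where
  "partition_function = fps_exp 1 oo free_energy_sum"

end

(* Dropping the transitivity condition, monotone sequences of m transpositions in S_d are counted by
   the complete homogeneous symmetric polynomial h_m(1, ..., d - 1). Splitting off the orbit of a
   point (the exponential formula, in the differentiated form Z' = F' Z) shows that
     Z = sum_d x^d / (d! hbar^d) * prod_(k < d) 1 / (1 - k hbar),
   and the equation is the resulting two-term recursion between consecutive coefficients.
   Riemann-Hurwitz guarantees that every transitive sequence is counted by exactly one pair (g, n). *)
theory Submission
  imports Defs "HOL-Combinatorics.Cycles" "HOL-Library.Multiset"
begin

subsection \<open>Monotone sequences of transpositions\<close>

text \<open>Since 2g - 2 + n = m - d, the exponent of hbar sees only the number m of transpositions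
  and the number d of points: each transposition gets weight hbar, each point weight x / hbar. Both
  m and d are additive over components, so these weights pass through the exponential formula. The
  n! labellings of the cycles of one sequence cancel the factor 1/n! of the exponent.

  Two obstacles shape the argument. A component is an arbitrary subset of {1..d}, not an initial
  segment, so sequences are counted over any finite set of naturals, and the counts must be shown to
  depend on its size only. And the exponent has genuine negative powers of hbar, so the comparison
  of coefficients takes place over Laurent series, while the counting series themselves are power
  series.\<close>

definition mono_lists :: "nat set \<Rightarrow> nat \<Rightarrow> (nat \<times> nat) list set" where
  "mono_lists S m = {ts. length ts = m \<and> (\<forall>(a, b) \<in> set ts. a \<in> S \<and> b \<in> S \<and> a < b)
                         \<and> sorted (map snd ts)}"

lemma finite_mono_lists:
  assumes "finite S"
  shows "finite (mono_lists S m)"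
proof (rule finite_subset)
  show "mono_lists S m \<subseteq> {ts. set ts \<subseteq> S \<times> S \<and> length ts = m}"
    by (auto simp: mono_lists_def)
  show "finite {ts. set ts \<subseteq> S \<times> S \<and> length ts = m}"
    using assms by (intro finite_lists_length_eq) auto
qed

lemma mono_lists_0 [simp]: "mono_lists S 0 = {[]}"
  by (auto simp: mono_lists_def)

lemma mono_lists_empty_Suc [simp]: "mono_lists {} (Suc m) = {}"
proof -
  have False if "ts \<in> mono_lists {} (Suc m)" for ts
    using that by (cases ts) (auto simp: mono_lists_def split: prod.splits)
  then show ?thesis
    by blast
qed

text \<open>Either the last transposition moves the maximum, or no transposition does.\<close>
lemma card_mono_lists_insert:
  assumes fin: "finite S" and x: "\<And>y. y \<in> S \<Longrightarrow> y < x"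
  shows "card (mono_lists (insert x S) (Suc m)) =
           card (mono_lists S (Suc m)) + card S * card (mono_lists (insert x S) m)"
proof -
  define A where "A = mono_lists S (Suc m)"
  define h where "h = (\<lambda>(ts, a :: nat). ts @ [(a, x)])"
  define C where "C = mono_lists (insert x S) m \<times> S"
  have xS: "x \<notin> S"
    using x by blast
  have "ts \<in> A \<union> h ` C" if ts: "ts \<in> mono_lists (insert x S) (Suc m)" for ts
  proof -
    from ts have "ts \<noteq> []"
      by (auto simp: mono_lists_def)
    then obtain us a b where us: "ts = us @ [(a, b)]"
      by (metis rev_exhaust surj_pair)
    show ?thesis
    proof (cases "b = x")
      case True
      have "a \<in> S"
        using ts us True by (auto simp: mono_lists_def)
      moreover have "us \<in> mono_lists (insert x S) m"
        using ts us by (auto simp: mono_lists_def sorted_append)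
      ultimately have "ts = h (us, a)" "(us, a) \<in> C"
        using us True by (auto simp: h_def C_def)
      then show ?thesis
        by blast
    next
      case False
      have "b \<in> S"
        using ts us False by (auto simp: mono_lists_def)
      \<comment> \<open>Sortedness bounds every larger entry by the last one, which lies below
        \<open>x\<close>; smaller entries are below larger ones, so \<open>x\<close> does not occur
        at all.\<close>
      then have "d < x" if "(c, d) \<in> set ts" for c d
        using ts us that x by (fastforce simp: mono_lists_def sorted_append)
      then have "ts \<in> A"
        using ts unfolding A_def mono_lists_def by fastforce
      then show ?thesis
        by blast
    qed
  qed
  moreover have "A \<subseteq> mono_lists (insert x S) (Suc m)"
    by (auto simp: A_def mono_lists_def)
  moreover have "h ` C \<subseteq> mono_lists (insert x S) (Suc m)"
    using x by (fastforce simp: h_def C_def mono_lists_def sorted_append)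
  ultimately have eq: "mono_lists (insert x S) (Suc m) = A \<union> h ` C"
    by blast
  have "A \<inter> h ` C = {}"
    using xS by (auto simp: A_def h_def mono_lists_def)
  moreover have "inj_on h C"
    by (auto simp: h_def inj_on_def)
  moreover have "finite A" "finite C"
    using fin by (auto simp: A_def C_def finite_mono_lists)
  ultimately show ?thesis
    by (simp add: eq card_Un_disjoint card_image C_def card_cartesian_product mult.commute flip: A_def)
qed

definition mono_count :: "nat \<Rightarrow> nat \<Rightarrow> nat" where
  "mono_count d m = card (mono_lists {1..d} m)"

lemma mono_count_0 [simp]: "mono_count d 0 = 1"
  by (simp add: mono_count_def)

lemma mono_count_0_Suc [simp]: "mono_count 0 (Suc m) = 0"
  by (simp add: mono_count_def)

lemma mono_count_Suc_Suc:
  "mono_count (Suc d) (Suc m) = mono_count d (Suc m) + d * mono_count (Suc d) m"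
proof -
  have "{1..Suc d} = insert (Suc d) {1..d}"
    by auto
  then show ?thesis
    unfolding mono_count_def using card_mono_lists_insert[of "{1..d}" "Suc d" m] by simp
qed

text \<open>Components are arbitrary sets, but the recursion sees only the number of elements below
  the maximum. The induction adds elements in increasing order so that each new one is a
  maximum.\<close>

lemma card_mono_lists:
  assumes "finite S"
  shows "card (mono_lists S m) = mono_count (card S) m"
  using assms
proof (induction S arbitrary: m rule: finite_linorder_max_induct)
  case empty
  then show ?case
    by (simp add: mono_count_def)
next
  case (insert x S)
  then have "x \<notin> S"
    by blast
  show ?case
  proof (induction m)
    case (Suc m)
    then show ?case
      using insert \<open>x \<notin> S\<close> by (simp add: card_mono_lists_insert mono_count_Suc_Suc)
  qed simp
qed

subsection \<open>Connected components\<close>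

text \<open>A transposition is stored once, as a pair with the smaller entry first, hence the
  symmetrisation before taking the closure.\<close>

definition linked :: "('a \<times> 'a) set \<Rightarrow> ('a \<times> 'a) set" where
  "linked E = (E \<union> E\<inverse>)\<^sup>*"

lemma linked_refl [simp, intro]: "(x, x) \<in> linked E"
  by (simp add: linked_def)

lemma linked_trans: "(x, y) \<in> linked E \<Longrightarrow> (y, z) \<in> linked E \<Longrightarrow> (x, z) \<in> linked E"
  unfolding linked_def by (rule rtrancl_trans)

lemma linked_sym: "(x, y) \<in> linked E \<Longrightarrow> (y, x) \<in> linked E"
proof -
  have "sym (E \<union> E\<inverse>)"
    by (auto simp: sym_def)
  then show "(x, y) \<in> linked E \<Longrightarrow> (y, x) \<in> linked E"
    unfolding linked_def by (meson sym_rtrancl symD)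
qed

lemma linked_edge: "(x, y) \<in> E \<Longrightarrow> (x, y) \<in> linked E"
  by (auto simp: linked_def)

lemma linked_mono: "E \<subseteq> F \<Longrightarrow> linked E \<subseteq> linked F"
  unfolding linked_def by (intro rtrancl_mono) auto

lemma linked_closed:
  assumes "(x, y) \<in> linked E" and "x \<in> B" and "\<And>a b. (a, b) \<in> E \<Longrightarrow> a \<in> B \<longleftrightarrow> b \<in> B"
  shows "y \<in> B"
  using assms(1) unfolding linked_def
  by (induction rule: rtrancl_induct) (use assms(2,3) in auto)

definition component :: "('a \<times> 'a) set \<Rightarrow> 'a \<Rightarrow> 'a set" where
  "component E x = linked E `` {x}"

lemma mem_component_iff [simp]: "y \<in> component E x \<longleftrightarrow> (x, y) \<in> linked E"
  by (simp add: component_def)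

lemma component_eq_iff: "component E x = component E y \<longleftrightarrow> (x, y) \<in> linked E"
  by (auto simp: set_eq_iff intro: linked_trans linked_sym)

section \<open>The exponential formula for monotone sequences\<close>

definition conn_lists :: "nat set \<Rightarrow> nat \<Rightarrow> (nat \<times> nat) list set" where
  "conn_lists S m = {ts \<in> mono_lists S m. \<forall>i\<in>S. \<forall>j\<in>S. (i, j) \<in> linked (set ts)}"

lemma finite_conn_lists: "finite S \<Longrightarrow> finite (conn_lists S m)"
  unfolding conn_lists_def by (simp add: finite_mono_lists)

text \<open>\<open>P\<close> depends on the key alone, so all elements with a given key fall on the
  same side of the split and keep their relative order; stable sorting then restores the
  list.\<close>

lemma sort_key_split:
  assumes "sorted (map f xs)" and "\<And>x. x \<in> set xs \<Longrightarrow> P x \<longleftrightarrow> f x \<in> B"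
  shows "sort_key f (filter P xs @ filter (\<lambda>x. \<not> P x) xs) = xs"
proof (rule properties_for_sort_key)
  fix k assume k: "k \<in> set xs"
  show "filter (\<lambda>x. f k = f x) xs =
          filter (\<lambda>x. f k = f x) (filter P xs @ filter (\<lambda>x. \<not> P x) xs)"
  proof (cases "f k \<in> B")
    case True
    then have "filter (\<lambda>x. \<not> P x \<and> f k = f x) xs = []"
      and "filter (\<lambda>x. P x \<and> f k = f x) xs = filter (\<lambda>x. f k = f x) xs"
      using assms(2) by (auto simp: filter_empty_conv intro!: filter_cong)
    then show ?thesis
      by (simp add: conj_commute)
  next
    case False
    then have "filter (\<lambda>x. P x \<and> f k = f x) xs = []"
      and "filter (\<lambda>x. \<not> P x \<and> f k = f x) xs = filter (\<lambda>x. f k = f x) xs"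
      using assms(2) by (auto simp: filter_empty_conv intro!: filter_cong)
    then show ?thesis
      by (simp add: conj_commute)
  qed
qed (use assms(1) in auto)

text \<open>Split off the component of \<open>s\<close>. Transpositions from different components have different
  larger entries, so a monotone sequence is recovered from its two parts by stable sorting.\<close>
lemma card_mono_lists_component:
  assumes fin: "finite S" and s: "s \<in> S"
  shows "card (mono_lists S m) = (\<Sum>B | B \<subseteq> S \<and> s \<in> B.
           \<Sum>i\<le>m. card (conn_lists B i) * card (mono_lists (S - B) (m - i)))"
proof -
  \<comment> \<open>The length \<open>i\<close> is determined by the first list; recording it makes
    the cardinality of \<open>T\<close> the required double sum.\<close>
  define T where "T = (SIGMA B:{B. B \<subseteq> S \<and> s \<in> B}. SIGMA i:{..m}.
                         conn_lists B i \<times> mono_lists (S - B) (m - i))"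
  \<comment> \<open>Testing the larger entry is enough, since both entries of a transposition lie in
    the same component.\<close>
  define part where "part = (\<lambda>B (ts :: (nat \<times> nat) list). filter (\<lambda>e. snd e \<in> B) ts)"
  define rest where "rest = (\<lambda>B (ts :: (nat \<times> nat) list). filter (\<lambda>e. \<not> snd e \<in> B) ts)"
  define split where "split = (\<lambda>ts. let B = component (set ts) s in
                         (B, length (part B ts), part B ts, rest B ts))"
  define merge where
    "merge = (\<lambda>(B :: nat set, i :: nat, us, vs). sort_key snd (us @ vs :: (nat \<times> nat) list))"
  have "bij_betw split (mono_lists S m) T"
  proof (rule bij_betw_byWitness[where f' = merge])
    show "\<forall>ts\<in>mono_lists S m. merge (split ts) = ts"
    proof
      fix ts assume ts: "ts \<in> mono_lists S m"
      show "merge (split ts) = ts"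
        using sort_key_split[of snd ts "\<lambda>e. snd e \<in> component (set ts) s" "component (set ts) s"] ts
        by (simp add: merge_def split_def part_def rest_def Let_def mono_lists_def)
    qed
    show "split ` mono_lists S m \<subseteq> T"
    proof (rule image_subsetI)
      fix ts assume ts: "ts \<in> mono_lists S m"
      define B where "B = component (set ts) s"
      have edge: "a \<in> B \<longleftrightarrow> b \<in> B" if "(a, b) \<in> set ts" for a b
        using linked_edge[OF that] unfolding B_def by (auto intro: linked_trans linked_sym)
      have "B \<subseteq> S"
        using ts s unfolding B_def
        using linked_closed[where x = s and E = "set ts" and B = S]
        by (fastforce simp: mono_lists_def)
      \<comment> \<open>A path that starts at \<open>s\<close> never leaves \<open>B\<close>, so all
        its edges survive in \<open>part B ts\<close>.\<close>
      have "(s, x) \<in> linked (set (part B ts))" if "(s, x) \<in> linked (set ts)" for x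
        using that unfolding linked_def[of "set ts"]
      proof (induction rule: rtrancl_induct)
        case (step y z)
        from step(1) have y: "y \<in> B"
          by (simp add: B_def linked_def)
        from step(2) consider "(y, z) \<in> set ts" | "(z, y) \<in> set ts"
          by auto
        then have "(y, z) \<in> linked (set (part B ts))"
        proof cases
          case 1
          then show ?thesis
            using y edge by (intro linked_edge) (auto simp: part_def)
        next
          case 2
          then show ?thesis
            using y edge by (intro linked_sym[OF linked_edge]) (auto simp: part_def)
        qed
        with step show ?case
          by (blast intro: linked_trans)
      qed auto
      then have "(x, y) \<in> linked (set (part B ts))" if "x \<in> B" "y \<in> B" for x y
        using that unfolding B_def by (auto intro: linked_trans linked_sym)
      moreover have "part B ts \<in> mono_lists B (length (part B ts))"
        using ts edge by (auto simp: mono_lists_def part_def intro: sorted_filter)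
      moreover have "length (part B ts) \<le> m" "length (rest B ts) = m - length (part B ts)"
        using ts sum_length_filter_compl[of "\<lambda>e. snd e \<in> B" ts]
        by (auto simp: mono_lists_def part_def rest_def)
      moreover have "rest B ts \<in> mono_lists (S - B) (length (rest B ts))"
        using ts edge by (auto simp: mono_lists_def rest_def intro: sorted_filter)
      ultimately show "split ts \<in> T"
        using \<open>B \<subseteq> S\<close>
        by (auto simp: split_def T_def Let_def conn_lists_def B_def)
    qed
    have *: "merge q \<in> mono_lists S m \<and> split (merge q) = q" if q: "q \<in> T" for q
    proof -
      obtain B i us vs where q_eq: "q = (B, i, us, vs)"
        by (cases q) auto
      have B: "B \<subseteq> S" "s \<in> B" and i: "i \<le> m" and us: "us \<in> conn_lists B i"
        and vs: "vs \<in> mono_lists (S - B) (m - i)"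
        using q by (auto simp: q_eq T_def)
      define ts where "ts = sort_key snd (us @ vs)"
      have us': "a \<in> B \<and> b \<in> B \<and> a < b" if "(a, b) \<in> set us" for a b
        using us that by (auto simp: conn_lists_def mono_lists_def)
      have vs': "a \<in> S - B \<and> b \<in> S - B \<and> a < b" if "(a, b) \<in> set vs" for a b
        using vs that by (auto simp: mono_lists_def)
      have set_ts: "set ts = set us \<union> set vs"
        by (simp add: ts_def)
      have ts: "ts \<in> mono_lists S m"
        using us vs i B us' vs' by (auto simp: mono_lists_def conn_lists_def ts_def)
      \<comment> \<open>No transposition of either list crosses the boundary of \<open>B\<close>,
        and those of \<open>us\<close> already connect \<open>B\<close>.\<close>
      have "component (set ts) s = B"
      proof
        show "component (set ts) s \<subseteq> B"
        proof
          fix x assume "x \<in> component (set ts) s"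
          then have "(s, x) \<in> linked (set ts)"
            by simp
          then show "x \<in> B"
            by (rule linked_closed) (use B us' vs' in \<open>auto simp: set_ts\<close>)
        qed
        have "linked (set us) \<subseteq> linked (set ts)"
          by (rule linked_mono) (simp add: set_ts)
        moreover have "(s, x) \<in> linked (set us)" if "x \<in> B" for x
          using us B that by (auto simp: conn_lists_def)
        ultimately show "B \<subseteq> component (set ts) s"
          unfolding component_def by blast
      qed
      moreover have "filter (\<lambda>e. snd e \<in> B) us = us" "filter (\<lambda>e. snd e \<in> B) vs = []"
        "filter (\<lambda>e. snd e \<notin> B) us = []" "filter (\<lambda>e. snd e \<notin> B) vs = vs"
        using us' vs' by (auto simp: filter_id_conv filter_empty_conv)
      \<comment> \<open>Filtering commutes with stable sorting, and both lists are already
        sorted.\<close>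
      then have "part B ts = us" "rest B ts = vs"
        using us vs
        by (auto simp: part_def rest_def ts_def filter_sort conn_lists_def mono_lists_def
                 intro: sort_key_id_if_sorted)
      moreover have "length us = i"
        using us by (auto simp: conn_lists_def mono_lists_def)
      ultimately have "split ts = q"
        by (simp add: split_def q_eq Let_def)
      moreover have "merge q = ts"
        by (simp add: merge_def q_eq ts_def)
      ultimately show ?thesis
        using ts by simp
    qed
    then show "\<forall>q\<in>T. split (merge q) = q" and "merge ` T \<subseteq> mono_lists S m"
      by auto
  qed
  then have "card (mono_lists S m) = card T"
    by (rule bij_betw_same_card)
  also have "\<dots> = (\<Sum>B | B \<subseteq> S \<and> s \<in> B. \<Sum>i\<le>m. card (conn_lists B i) * card (mono_lists (S - B) (m - i)))"
  proof -
    have "finite {B. B \<subseteq> S \<and> s \<in> B}"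
      using fin by auto
    moreover have "finite (conn_lists B i \<times> mono_lists (S - B) (m - i))" if "B \<subseteq> S" for B i
      using that fin by (auto intro: finite_conn_lists finite_mono_lists finite_subset)
    ultimately show ?thesis
      unfolding T_def by (subst card_SigmaI) (auto simp: card_cartesian_product)
  qed
  finally show ?thesis .
qed

definition conn_count :: "nat \<Rightarrow> nat \<Rightarrow> nat" where
  "conn_count d m = card (conn_lists {1..d} m)"

text \<open>Deleting \<open>s\<close> turns the blocks through \<open>s\<close> into all subsets of
  \<open>S\<close>, which are then grouped by size.\<close>

lemma sum_subsets_containing:
  fixes h :: "nat \<Rightarrow> 'a::comm_semiring_1"
  assumes "finite S" and "s \<notin> S"
  shows "(\<Sum>B | B \<subseteq> insert s S \<and> s \<in> B. h (card B)) =
           (\<Sum>k\<le>card S. of_nat (card S choose k) * h (Suc k))"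
proof -
  have img: "{B. B \<subseteq> insert s S \<and> s \<in> B} = insert s ` Pow S"
  proof (intro equalityI subsetI)
    fix B assume "B \<in> {B. B \<subseteq> insert s S \<and> s \<in> B}"
    then have "B = insert s (B - {s})" "B - {s} \<in> Pow S"
      by auto
    then show "B \<in> insert s ` Pow S"
      by blast
  qed auto
  have inj: "inj_on (insert s) (Pow S)"
    using assms(2) by (auto simp: inj_on_def)
  have "(\<Sum>B | B \<subseteq> insert s S \<and> s \<in> B. h (card B)) = (\<Sum>B\<in>Pow S. h (card (insert s B)))"
    unfolding img by (subst sum.reindex[OF inj]) simp
  also have "\<dots> = (\<Sum>B\<in>Pow S. h (Suc (card B)))"
  proof (rule sum.cong)
    fix B assume "B \<in> Pow S"
    then have "finite B" "s \<notin> B"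
      using assms by (auto intro: finite_subset)
    then show "h (card (insert s B)) = h (Suc (card B))"
      by simp
  qed simp
  also have "\<dots> = (\<Sum>k\<le>card S. \<Sum>B | B \<in> Pow S \<and> card B = k. h (Suc (card B)))"
    using assms by (intro sum.group[symmetric]) (auto intro: card_mono)
  also have "\<dots> = (\<Sum>k\<le>card S. of_nat (card S choose k) * h (Suc k))"
  proof (rule sum.cong)
    fix k
    have "card {B. B \<subseteq> S \<and> card B = k} = card S choose k"
      using assms(1) by (rule n_subsets)
    then show "(\<Sum>B | B \<in> Pow S \<and> card B = k. h (Suc (card B))) = of_nat (card S choose k) * h (Suc k)"
      by simp
  qed simp
  finally show ?thesis .
qed

text \<open>The component identity determines the connected count of a set from counts of its proper
  subsets and from its size. Applying it both to \<open>S\<close> and to {1..d} and comparing gives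
  the claim by strong induction, without relabelling sequences.\<close>

lemma card_conn_lists:
  assumes "finite S"
  shows "card (conn_lists S m) = conn_count (card S) m"
  using assms
proof (induction "card S" arbitrary: S m rule: less_induct)
  case less
  define d where "d = card S"
  define h where "h = (\<lambda>k. \<Sum>i\<le>m. conn_count k i * mono_count (d - k) (m - i))"
  \<comment> \<open>The set \<open>U\<close> is arbitrary of size \<open>d\<close> because both
    \<open>S\<close> and {1..d} are needed.\<close>
  have h_proper: "(\<Sum>i\<le>m. card (conn_lists B i) * card (mono_lists (U - B) (m - i))) = h (card B)"
    if "finite U" "card U = d" "B \<subset> U" for U B
  proof -
    have "card B < d" "finite B"
      using that psubset_card_mono[of U B] by (auto intro: finite_subset)
    then show ?thesis
      using that less by (auto simp: h_def d_def card_mono_lists card_Diff_subset)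
  qed
  show ?case
  proof (cases "d = 0")
    case True
    then have "S = {}"
      using less by (simp add: d_def)
    then show ?thesis
      by (simp add: conn_count_def)
  next
    case False
    \<comment> \<open>The block \<open>B = U\<close> is the one not covered by induction. Adding
      \<open>h d\<close> on the left completes the sum over the other blocks to a sum over all
      blocks, without subtraction.\<close>
    have eq: "mono_count d m + h d = card (conn_lists U m) +
                 (\<Sum>k\<le>d - 1. (d - 1 choose k) * h (Suc k))"
      if U: "finite U" "card U = d" for U
    proof -
      obtain s where s: "s \<in> U"
        using U False by fastforce
      define P where "P = {B. B \<subseteq> U \<and> s \<in> B}"
      have P: "finite P" "U \<in> P"
        using U s by (auto simp: P_def)
      \<comment> \<open>For the full block nothing is left over, so the second list is empty and
        only \<open>i = m\<close> contributes.\<close>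
      have top: "(\<Sum>i\<le>m. card (conn_lists U i) * card (mono_lists (U - U) (m - i))) =
                   card (conn_lists U m)"
      proof -
        have "(\<Sum>i\<le>m. card (conn_lists U i) * card (mono_lists (U - U) (m - i))) =
                (\<Sum>i\<le>m. if i = m then card (conn_lists U i) else 0)"
        proof (rule sum.cong)
          fix i assume "i \<in> {..m}"
          then show "card (conn_lists U i) * card (mono_lists (U - U) (m - i)) =
                       (if i = m then card (conn_lists U i) else 0)"
            by (cases "m - i") auto
        qed simp
        then show ?thesis
          by simp
      qed
      have "mono_count d m =
              (\<Sum>B\<in>P. \<Sum>i\<le>m. card (conn_lists B i) * card (mono_lists (U - B) (m - i)))"
        using card_mono_lists_component[OF U(1) s, of m] card_mono_lists[OF U(1), of m] U(2)
        by (simp add: P_def)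
      also have "\<dots> = card (conn_lists U m) + (\<Sum>B\<in>P - {U}.
                       \<Sum>i\<le>m. card (conn_lists B i) * card (mono_lists (U - B) (m - i)))"
        unfolding sum.remove[OF P] top ..
      also have "(\<Sum>B\<in>P - {U}. \<Sum>i\<le>m. card (conn_lists B i) * card (mono_lists (U - B) (m - i))) =
                 (\<Sum>B\<in>P - {U}. h (card B))"
        by (intro sum.cong refl h_proper) (use U in \<open>auto simp: P_def\<close>)
      finally have "mono_count d m + h d = card (conn_lists U m) + (\<Sum>B\<in>P. h (card B))"
        using P U by (simp add: sum.remove[of P U])
      also have "(\<Sum>B\<in>P. h (card B)) = (\<Sum>k\<le>d - 1. (d - 1 choose k) * h (Suc k))"
        using sum_subsets_containing[of "U - {s}" s h] U s by (simp add: P_def insert_absorb)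
      finally show ?thesis .
    qed
    from eq[of S] eq[of "{1..d}"] less.prems show ?thesis
      by (simp add: d_def conn_count_def)
  qed
qed

text \<open>This is \<open>Z' = F' Z\<close> read off at one coefficient: \<open>k\<close> is the
  number of points other than 1 in the component of 1.\<close>

lemma mono_count_Suc:
  "mono_count (Suc d) m = (\<Sum>k\<le>d. (d choose k) *
     (\<Sum>i\<le>m. conn_count (Suc k) i * mono_count (d - k) (m - i)))"
proof -
  define U where "U = {1..Suc d}"
  define h where "h = (\<lambda>k. \<Sum>i\<le>m. conn_count k i * mono_count (Suc d - k) (m - i))"
  have U: "finite U" "card U = Suc d" "1 \<in> U"
    by (auto simp: U_def)
  have "mono_count (Suc d) m = (\<Sum>B | B \<subseteq> U \<and> 1 \<in> B. h (card B))"
    unfolding mono_count_def U_def[symmetric] card_mono_lists_component[OF U(1,3)]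
  proof (rule sum.cong)
    fix B assume "B \<in> {B. B \<subseteq> U \<and> 1 \<in> B}"
    then have "B \<subseteq> U" "finite B"
      using U by (auto intro: finite_subset)
    then show "(\<Sum>i\<le>m. card (conn_lists B i) * card (mono_lists (U - B) (m - i))) = h (card B)"
      using U by (simp add: h_def card_conn_lists card_mono_lists card_Diff_subset)
  qed simp
  also have "\<dots> = (\<Sum>k\<le>d. (d choose k) * h (Suc k))"
    using sum_subsets_containing[of "U - {1}" 1 h] U by (simp add: insert_absorb)
  finally show ?thesis
    by (simp add: h_def)
qed

subsection \<open>The Riemann--Hurwitz relation\<close>

lemma self_in_cycle_of [simp, intro]: "x \<in> cycle_of \<sigma> x"
  unfolding cycle_of_def by (auto intro: exI[of _ 0])

lemma cycle_of_step: "y \<in> cycle_of \<sigma> x \<Longrightarrow> \<sigma> y \<in> cycle_of \<sigma> x"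
  unfolding cycle_of_def by (auto intro: exI[of _ "Suc j" for j])

lemma cycle_of_least:
  assumes "x \<in> A" and "\<And>y. y \<in> A \<Longrightarrow> \<sigma> y \<in> A"
  shows "cycle_of \<sigma> x \<subseteq> A"
proof -
  have "(\<sigma> ^^ j) x \<in> A" for j
    by (induction j) (use assms in auto)
  then show ?thesis
    by (auto simp: cycle_of_def)
qed

text \<open>\<open>cycle_of\<close> collects forward iterates only. A permutation has finite order,
  so iterating further from \<open>y\<close> returns to \<open>x\<close>, and forward orbits are
  equivalence classes.\<close>

lemma cycle_of_eq:
  assumes "permutation \<sigma>" and y: "y \<in> cycle_of \<sigma> x"
  shows "cycle_of \<sigma> y = cycle_of \<sigma> x"
proof
  show "cycle_of \<sigma> y \<subseteq> cycle_of \<sigma> x"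
    using y by (rule cycle_of_least) (rule cycle_of_step)
  obtain j where j: "y = (\<sigma> ^^ j) x"
    using y by (auto simp: cycle_of_def)
  obtain n where n: "\<sigma> ^^ n = id" "n > j"
    using permutation_is_nilpotent'[OF assms(1)] by blast
  then have "(\<sigma> ^^ (n - j)) y = (\<sigma> ^^ (n - j + j)) x"
    by (simp only: j funpow_add o_apply)
  then have "(\<sigma> ^^ (n - j)) y = x"
    using n by simp
  then have "x \<in> cycle_of \<sigma> y"
    by (auto simp: cycle_of_def)
  then show "cycle_of \<sigma> x \<subseteq> cycle_of \<sigma> y"
    by (rule cycle_of_least) (rule cycle_of_step)
qed

lemma cycle_of_eq_iff:
  assumes "permutation \<sigma>"
  shows "cycle_of \<sigma> y = cycle_of \<sigma> x \<longleftrightarrow> y \<in> cycle_of \<sigma> x"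
  using cycle_of_eq[OF assms] by blast

lemma cycle_of_pred:
  assumes "permutation \<sigma>"
  obtains z where "z \<in> cycle_of \<sigma> x" "\<sigma> z = x"
proof -
  obtain n where n: "\<sigma> ^^ n = id" "n > 0"
    using permutation_is_nilpotent[OF assms] by blast
  then obtain k where "n = Suc k"
    by (cases n) auto
  with n have "\<sigma> ((\<sigma> ^^ k) x) = x"
    by (metis funpow.simps(2) id_apply o_apply)
  moreover have "(\<sigma> ^^ k) x \<in> cycle_of \<sigma> x"
    by (auto simp: cycle_of_def)
  ultimately show ?thesis
    using that by blast
qed

text \<open>Started at \<open>a\<close>, the new permutation follows the old cycle, which avoids
  \<open>b\<close>, up to the point whose image is \<open>a\<close>; there it jumps to
  \<open>b\<close> instead.\<close>

lemma cycle_of_transpose_superset: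
  assumes \<sigma>: "permutation \<sigma>" and b: "b \<notin> cycle_of \<sigma> a"
  shows "cycle_of \<sigma> a \<subseteq> cycle_of (transpose a b \<circ> \<sigma>) a"
    and "b \<in> cycle_of (transpose a b \<circ> \<sigma>) a"
proof -
  define \<tau> where "\<tau> = transpose a b \<circ> \<sigma>"
  have "cycle_of \<sigma> a \<subseteq> cycle_of \<sigma> a \<inter> cycle_of \<tau> a"
  proof (rule cycle_of_least)
    fix z assume z: "z \<in> cycle_of \<sigma> a \<inter> cycle_of \<tau> a"
    then have "\<sigma> z \<in> cycle_of \<sigma> a"
      by (auto intro: cycle_of_step)
    moreover from this have "\<sigma> z \<in> cycle_of \<tau> a"
      using b z cycle_of_step[of z \<tau> a] by (cases "\<sigma> z = a") (auto simp: \<tau>_def transpose_def split: if_splits)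
    ultimately show "\<sigma> z \<in> cycle_of \<sigma> a \<inter> cycle_of \<tau> a"
      by blast
  qed auto
  then show *: "cycle_of \<sigma> a \<subseteq> cycle_of (transpose a b \<circ> \<sigma>) a"
    by (simp add: \<tau>_def)
  obtain z where "z \<in> cycle_of \<sigma> a" "\<sigma> z = a"
    using cycle_of_pred[OF \<sigma>] by blast
  with * cycle_of_step[of z "transpose a b \<circ> \<sigma>" a] show "b \<in> cycle_of (transpose a b \<circ> \<sigma>) a"
    by auto
qed

text \<open>The previous lemma, used for \<open>a\<close>, \<open>b\<close> in both orders, shows
  that the new cycle of \<open>a\<close> contains both old cycles; their union is invariant, so
  nothing more is added.\<close>

lemma cycle_of_transpose_merge:
  assumes \<sigma>: "permutation \<sigma>" and b: "b \<notin> cycle_of \<sigma> a"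
  shows "cycle_of (transpose a b \<circ> \<sigma>) x =
           (if x \<in> cycle_of \<sigma> a \<union> cycle_of \<sigma> b then cycle_of \<sigma> a \<union> cycle_of \<sigma> b else cycle_of \<sigma> x)"
proof -
  define \<tau> where "\<tau> = transpose a b \<circ> \<sigma>"
  define U where "U = cycle_of \<sigma> a \<union> cycle_of \<sigma> b"
  have \<tau>: "permutation \<tau>"
    unfolding \<tau>_def using \<sigma> by (intro permutation_compose permutation_swap_id)
  have a: "a \<notin> cycle_of \<sigma> b"
    using cycle_of_eq[OF \<sigma>, of a b] b by auto
  have "cycle_of \<sigma> b \<subseteq> cycle_of \<tau> b"
    using cycle_of_transpose_superset(1)[OF \<sigma> a] by (simp add: \<tau>_def transpose_commute)
  moreover have "cycle_of \<tau> b = cycle_of \<tau> a"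
    using cycle_of_transpose_superset(2)[OF \<sigma> b] by (intro cycle_of_eq \<tau>) (simp add: \<tau>_def)
  ultimately have "U \<subseteq> cycle_of \<tau> a"
    using cycle_of_transpose_superset(1)[OF \<sigma> b] by (simp add: U_def \<tau>_def)
  moreover have "cycle_of \<tau> a \<subseteq> U"
  proof (rule cycle_of_least)
    fix y assume "y \<in> U"
    then have "\<sigma> y \<in> U"
      by (auto simp: U_def cycle_of_step)
    then show "\<tau> y \<in> U"
      by (auto simp: \<tau>_def transpose_def U_def)
  qed (simp add: U_def)
  ultimately have U: "cycle_of \<tau> a = U"
    by blast
  show ?thesis
  proof (cases "x \<in> U")
    case True
    then have "cycle_of \<tau> x = U"
      using cycle_of_eq[OF \<tau>, of x a] U by blast
    then show ?thesis
      using True by (simp add: U_def \<tau>_def)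
  next
    case False
    \<comment> \<open>The two permutations differ only at the preimages of \<open>a\<close> and
      \<open>b\<close>, and these lie on the merged cycles.\<close>
    have eq: "\<tau> z = \<sigma> z" if "z \<in> cycle_of \<sigma> x" for z
    proof -
      have "\<sigma> z \<in> cycle_of \<sigma> x"
        using that by (rule cycle_of_step)
      then have "x \<in> cycle_of \<sigma> (\<sigma> z)"
        using cycle_of_eq[OF \<sigma>] by blast
      then have "\<sigma> z \<noteq> a" "\<sigma> z \<noteq> b"
        using False by (auto simp: U_def)
      then show ?thesis
        by (simp add: \<tau>_def)
    qed
    have "cycle_of \<tau> x \<subseteq> cycle_of \<sigma> x"
      by (rule cycle_of_least) (auto simp: eq cycle_of_step)
    moreover have "cycle_of \<sigma> x \<subseteq> cycle_of \<sigma> x \<inter> cycle_of \<tau> x"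
      proof (rule cycle_of_least)
      fix z assume z: "z \<in> cycle_of \<sigma> x \<inter> cycle_of \<tau> x"
      then have "\<tau> z \<in> cycle_of \<tau> x"
        by (auto intro: cycle_of_step)
      then show "\<sigma> z \<in> cycle_of \<sigma> x \<inter> cycle_of \<tau> x"
        using z eq by (auto intro: cycle_of_step)
    qed simp
    ultimately show ?thesis
      using False by (auto simp: U_def \<tau>_def)
  qed
qed

text \<open>If \<open>b\<close> is first reached from \<open>a\<close> after \<open>j\<close> steps,
  the transposition redirects the last of these steps to \<open>a\<close>, closing the first
  \<open>j\<close> points into a cycle without \<open>b\<close>.\<close>

lemma cycle_of_transpose_split:
  assumes \<sigma>: "permutation \<sigma>" and "a \<noteq> b" and b: "b \<in> cycle_of \<sigma> a"
  shows "b \<notin> cycle_of (transpose a b \<circ> \<sigma>) a"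
proof -
  define j where "j = (LEAST j. (\<sigma> ^^ j) a = b)"
  obtain j' where "(\<sigma> ^^ j') a = b"
    using b by (auto simp: cycle_of_def)
  then have j: "(\<sigma> ^^ j) a = b"
    unfolding j_def by (rule LeastI)
  have min: "(\<sigma> ^^ i) a \<noteq> b" if "i < j" for i
    using that unfolding j_def by (rule not_less_Least)
  have "j > 0"
    using j \<open>a \<noteq> b\<close> by (cases j) auto
  \<comment> \<open>An earlier return to \<open>a\<close> after \<open>i\<close> steps would bring
    \<open>b\<close> after only \<open>j - i\<close> steps.\<close>
  have no_return: "(\<sigma> ^^ i) a \<noteq> a" if "0 < i" "i < j" for i
  proof
    assume "(\<sigma> ^^ i) a = a"
    then have "(\<sigma> ^^ (j - i)) a = (\<sigma> ^^ (j - i + i)) a"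
      by (simp only: funpow_add o_apply)
    then have "(\<sigma> ^^ (j - i)) a = b"
      using that j by simp
    then show False
      using min[of "j - i"] that by simp
  qed
  have "cycle_of (transpose a b \<circ> \<sigma>) a \<subseteq> {(\<sigma> ^^ i) a | i. i < j}"
  proof (rule cycle_of_least)
    show "a \<in> {(\<sigma> ^^ i) a | i. i < j}"
      using \<open>j > 0\<close> by (auto intro: exI[of _ 0])
    fix y assume "y \<in> {(\<sigma> ^^ i) a | i. i < j}"
    then obtain i where i: "y = (\<sigma> ^^ i) a" "i < j"
      by blast
    show "(transpose a b \<circ> \<sigma>) y \<in> {(\<sigma> ^^ i) a | i. i < j}"
    proof (cases "Suc i = j")
      case True
      then have "(transpose a b \<circ> \<sigma>) y = (\<sigma> ^^ 0) a"
        using i j by auto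
      then show ?thesis
        using \<open>j > 0\<close> by blast
    next
      case False
      then have "Suc i < j"
        using i by simp
      then have "(transpose a b \<circ> \<sigma>) y = (\<sigma> ^^ Suc i) a"
        using i min[of "Suc i"] no_return[of "Suc i"] by simp
      then show ?thesis
        using \<open>Suc i < j\<close> by blast
    qed
  qed
  then show ?thesis
    using min by blast
qed

text \<open>Used twice: for cycles merged by a transposition and for components merged by an edge.
  Without the class of \<open>b\<close>, the maps \<open>f\<close> and \<open>g\<close> induce the
  same partition, and \<open>g\<close> loses no value.\<close>

lemma card_image_eq_merge:
  assumes fin: "finite D" and D: "a \<in> D" "b \<in> D" and ne: "f a \<noteq> f b"
    and merge: "\<And>x y. x \<in> D \<Longrightarrow> y \<in> D \<Longrightarrow>
       g x = g y \<longleftrightarrow> f x = f y \<or> f x \<in> {f a, f b} \<and> f y \<in> {f a, f b}"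
  shows "card (f ` D) = Suc (card (g ` D))"
proof -
  define D' where "D' = {x \<in> D. f x \<noteq> f b}"
  have "g x \<in> g ` D'" if "x \<in> D" for x
  proof (cases "f x = f b")
    case True
    then have "g x = g a"
      using merge that D by simp
    then show ?thesis
      using D ne by (auto simp: D'_def)
  qed (use that in \<open>auto simp: D'_def\<close>)
  then have g: "g ` D = g ` D'"
    by (auto simp: D'_def)
  have eq: "f x = f y \<longleftrightarrow> g x = g y" if "x \<in> D'" "y \<in> D'" for x y
    using that merge[of x y] by (auto simp: D'_def)
  have "card (f ` D') = card (g ` D')"
  proof (rule bij_betw_same_card)
    show "bij_betw (\<lambda>c. g (inv_into D' f c)) (f ` D') (g ` D')"
      unfolding bij_betw_def
    proof
      show "inj_on (\<lambda>c. g (inv_into D' f c)) (f ` D')"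
        by (rule inj_onI) (metis eq f_inv_into_f inv_into_into)
      have "g (inv_into D' f (f x)) = g x" if "x \<in> D'" for x
        using that eq by (metis f_inv_into_f image_eqI inv_into_into)
      then show "(\<lambda>c. g (inv_into D' f c)) ` f ` D' = g ` D'"
        by (simp add: image_image)
    qed
  qed
  moreover have "f ` D' = f ` D - {f b}"
    by (auto simp: D'_def)
  ultimately show ?thesis
    using fin D g card_Suc_Diff1[of "f ` D" "f b"] by simp
qed

text \<open>A path through the new edge has both its endpoints attached to \<open>a\<close> or
  \<open>b\<close> by old edges; which of the two ends comes first is irrelevant.\<close>

lemma linked_insert_iff:
  "(x, y) \<in> linked (insert (a, b) E) \<longleftrightarrow> (x, y) \<in> linked E \<or>
     ((x, a) \<in> linked E \<or> (x, b) \<in> linked E) \<and> ((y, a) \<in> linked E \<or> (y, b) \<in> linked E)"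
  (is "?L = ?R")
proof
  assume ?L
  then show ?R
    unfolding linked_def[of "insert (a, b) E"]
  proof (induction rule: rtrancl_induct)
    case (step y z)
    consider "(y, z) \<in> E \<or> (z, y) \<in> E" | "y = a" "z = b" | "y = b" "z = a"
      using step(2) by blast
    then show ?case
    proof cases
      case 1
      then have "(y, z) \<in> linked E" "(z, y) \<in> linked E"
        by (auto intro: linked_edge linked_sym)
      then show ?thesis
        using step(3) by (meson linked_trans)
    next
      case 2
      then show ?thesis
        using step(3) by auto
    next
      case 3
      then show ?thesis
        using step(3) by auto
    qed
  qed auto
next
  assume R: ?R
  have mono: "(p, q) \<in> linked (insert (a, b) E)" if "(p, q) \<in> linked E" for p q
    using that linked_mono[of E "insert (a, b) E"] by blast
  have "(b, a) \<in> linked (insert (a, b) E)"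
    by (intro linked_sym[OF linked_edge]) simp
  then have "(p, a) \<in> linked (insert (a, b) E)" if "(p, a) \<in> linked E \<or> (p, b) \<in> linked E" for p
    using that by (elim disjE) (auto dest: mono intro: linked_trans)
  with R mono show ?L
    by (meson linked_trans linked_sym)
qed

section \<open>Cycles and components of a product of transpositions\<close>

lemma tuple_perm_Nil [simp]: "tuple_perm [] = id"
  by (simp add: tuple_perm_def)

lemma tuple_perm_Cons [simp]: "tuple_perm ((a, b) # ts) = transpose a b \<circ> tuple_perm ts"
  by (simp add: tuple_perm_def)

lemma permutation_tuple_perm: "permutation (tuple_perm ts)"
proof (induction ts)
  case (Cons e ts)
  then show ?case
    by (cases e) (simp add: permutation_compose permutation_swap_id del: o_apply)
qed simp

lemma tuple_perm_permutes:
  assumes "set ts \<subseteq> D \<times> D"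
  shows "tuple_perm ts permutes D"
  using assms
proof (induction ts)
  case (Cons e ts)
  then show ?case
    by (cases e) (auto intro!: permutes_compose permutes_swap_id simp del: o_apply simp: tuple_perm_Cons)
qed (simp add: permutes_id)

text \<open>Each factor fixes a point or moves it along an edge.\<close>

lemma cycle_of_tuple_perm_subset: "cycle_of (tuple_perm ts) x \<subseteq> component (set ts) x"
proof (rule cycle_of_least)
  have "(y, tuple_perm ts y) \<in> linked (set ts)" for y
  proof (induction ts)
    case (Cons e ts)
    obtain a b where e: "e = (a, b)"
      by (cases e)
    have "(y, tuple_perm ts y) \<in> linked (set (e # ts))"
      using Cons linked_mono[of "set ts" "set (e # ts)"] by auto
    moreover have "(z, transpose a b z) \<in> linked (set (e # ts))" for z
      using linked_edge[of a b "set (e # ts)"] by (auto simp: e transpose_def intro: linked_sym)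
    ultimately show ?case
      by (auto simp: e intro: linked_trans)
  qed simp
  then show "tuple_perm ts y \<in> component (set ts) x" if "y \<in> component (set ts) x" for y
    using that by (auto intro: linked_trans)
qed simp

text \<open>Fixed points in \<open>D\<close> count as cycles of length 1.\<close>

definition num_cycles :: "nat set \<Rightarrow> (nat \<Rightarrow> nat) \<Rightarrow> nat" where
  "num_cycles D \<sigma> = card (cycle_of \<sigma> ` D)"

lemma num_cycles_transpose_merge:
  assumes "finite D" "a \<in> D" "b \<in> D" and \<sigma>: "permutation \<sigma>" and b: "b \<notin> cycle_of \<sigma> a"
  shows "num_cycles D \<sigma> = Suc (num_cycles D (transpose a b \<circ> \<sigma>))"
  unfolding num_cycles_def
proof (rule card_image_eq_merge[OF assms(1-3)])
  note iff = cycle_of_eq_iff[OF \<sigma>]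
  show "cycle_of \<sigma> a \<noteq> cycle_of \<sigma> b"
    using b by auto
  have merged: "cycle_of \<sigma> z \<noteq> cycle_of \<sigma> a \<union> cycle_of \<sigma> b" if "cycle_of \<sigma> z \<noteq> cycle_of \<sigma> a" for z
    using that iff[of a z] by auto
  show "cycle_of (transpose a b \<circ> \<sigma>) x = cycle_of (transpose a b \<circ> \<sigma>) y \<longleftrightarrow>
          cycle_of \<sigma> x = cycle_of \<sigma> y \<or>
          cycle_of \<sigma> x \<in> {cycle_of \<sigma> a, cycle_of \<sigma> b} \<and> cycle_of \<sigma> y \<in> {cycle_of \<sigma> a, cycle_of \<sigma> b}" for x y
    unfolding cycle_of_transpose_merge[OF \<sigma> b] insert_iff empty_iff Un_iff iff[symmetric]
    using merged[of x] merged[of y] by (simp split: if_split) metis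
qed

text \<open>A new transposition changes the number of cycles by exactly one, which gives the parity.
  If it joins two components, it also merges two cycles, and both sides of the inequality drop by
  one; otherwise the right side grows by one and the left by at most one. The empty sequence gives
  equality.\<close>

lemma riemann_hurwitz:
  assumes fin: "finite D" and "\<forall>(a, b)\<in>set ts. a \<in> D \<and> b \<in> D \<and> a \<noteq> b"
  shows "num_cycles D (tuple_perm ts) + card D \<le> length ts + 2 * card (component (set ts) ` D)
         \<and> even (num_cycles D (tuple_perm ts) + card D + length ts)"
  using assms(2)
proof (induction ts)
  case Nil
  have "cycle_of id x = {x}" "component {} x = {x}" for x :: nat
    by (auto simp: cycle_of_def component_def linked_def)
  then show ?case
    by (simp add: num_cycles_def card_image del: id_apply cong: image_cong_simp)
next
  case (Cons e ts)
  obtain a b where e: "e = (a, b)"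
    by (cases e)
  then have ab: "a \<in> D" "b \<in> D" "a \<noteq> b"
    using Cons.prems by auto
  define \<sigma> where "\<sigma> = tuple_perm ts"
  define \<tau> where "\<tau> = transpose a b \<circ> \<sigma>"
  have \<sigma>: "permutation \<sigma>"
    unfolding \<sigma>_def by (rule permutation_tuple_perm)
  then have \<tau>: "permutation \<tau>"
    unfolding \<tau>_def by (intro permutation_compose permutation_swap_id)
  \<comment> \<open>A transposition is an involution, so splitting a cycle of
    \<open>\<sigma>\<close> is a merge of two cycles of \<open>\<tau>\<close> read
    backwards.\<close>
  have \<sigma>_eq: "\<sigma> = transpose a b \<circ> \<tau>"
    by (auto simp: \<tau>_def fun_eq_iff)
  have cyc: "num_cycles D \<sigma> = Suc (num_cycles D \<tau>) \<and> b \<notin> cycle_of \<sigma> a \<or>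
             num_cycles D \<tau> = Suc (num_cycles D \<sigma>) \<and> b \<in> cycle_of \<sigma> a"
  proof (cases "b \<in> cycle_of \<sigma> a")
    case True
    then have "b \<notin> cycle_of \<tau> a"
      unfolding \<tau>_def using \<sigma> ab by (intro cycle_of_transpose_split)
    then show ?thesis
      using num_cycles_transpose_merge[OF fin ab(1,2) \<tau>] True by (simp flip: \<sigma>_eq)
  next
    case False
    then show ?thesis
      using num_cycles_transpose_merge[OF fin ab(1,2) \<sigma>] by (simp flip: \<tau>_def)
  qed
  have comp_le: "card (component (set ts) ` D) = Suc (card (component (set (e # ts)) ` D))"
    if "(a, b) \<notin> linked (set ts)"
    using that unfolding e
    by (intro card_image_eq_merge[OF fin ab(1,2)])
       (auto simp: component_eq_iff linked_insert_iff intro: linked_sym)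
  have comp_eq: "component (set (e # ts)) ` D = component (set ts) ` D"
    if "(a, b) \<in> linked (set ts)"
  proof -
    have "linked (set (e # ts)) = linked (set ts)"
      using that by (auto simp: e linked_insert_iff) (meson linked_trans linked_sym)+
    then show ?thesis
      by (simp add: component_def)
  qed
  \<comment> \<open>Cycles lie inside components, so joining two components can only merge
    cycles.\<close>
  have "b \<in> cycle_of \<sigma> a \<Longrightarrow> (a, b) \<in> linked (set ts)"
    using cycle_of_tuple_perm_subset[of ts a] by (auto simp: \<sigma>_def)
  then show ?case
    using Cons cyc comp_le comp_eq
    by (cases "(a, b) \<in> linked (set ts)") (auto simp: e simp flip: \<sigma>_def \<tau>_def)
qed

subsection \<open>Counting labelled sequences\<close>

lemma card_inj_on_extensional:
  assumes "finite C"
  shows "card {f \<in> C \<rightarrow>\<^sub>E {1..card C}. inj_on f C} = fact (card C)"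
  using card_inj_on_subset_funcset[of C "{1..card C}" C] assms
  by (simp add: fact_prod_rev)

text \<open>The prescribed cycle lengths are left out on purpose: they disappear in the sum over all
  compositions.\<close>

definition labellings :: "nat set \<Rightarrow> (nat \<Rightarrow> nat) \<Rightarrow> nat \<Rightarrow> (nat \<Rightarrow> nat) set" where
  "labellings D \<sigma> n = {L \<in> D \<rightarrow>\<^sub>E {1..n}. \<forall>i\<in>{1..n}. \<exists>k\<in>D. {c \<in> D. L c = i} = cycle_of \<sigma> k}"

text \<open>A labelling is constant on cycles and amounts to a bijection from the set of cycles to
  {1..n}. For equal sizes, bijections are encoded as injective extensional functions.\<close>

lemma card_labellings:
  assumes fin: "finite D" and \<sigma>: "\<sigma> permutes D"
  shows "card (labellings D \<sigma> n) = (if num_cycles D \<sigma> = n then fact n else 0)"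
proof -
  define C where "C = cycle_of \<sigma> ` D"
  have perm: "permutation \<sigma>"
    using fin \<sigma> by (auto simp: permutation_permutes)
  have sub: "cycle_of \<sigma> x \<subseteq> D" if "x \<in> D" for x
    using that by (rule cycle_of_least) (simp add: permutes_in_image[OF \<sigma>])
  note iff = cycle_of_eq_iff[OF perm]
  \<comment> \<open>The fibre through \<open>x\<close> is some cycle, and a cycle containing
    \<open>x\<close> is the cycle of \<open>x\<close>.\<close>
  have fiber: "{c \<in> D. L c = L x} = cycle_of \<sigma> x" if L: "L \<in> labellings D \<sigma> n" and x: "x \<in> D" for L x
  proof -
    have "L x \<in> {1..n}"
      using L x by (auto simp: labellings_def)
    then obtain k where k: "{c \<in> D. L c = L x} = cycle_of \<sigma> k"
      using L unfolding labellings_def by blast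
    with x have "x \<in> cycle_of \<sigma> k"
      by blast
    then have "cycle_of \<sigma> x = cycle_of \<sigma> k"
      by (rule cycle_of_eq[OF perm])
    then show ?thesis
      using k by simp
  qed
  have L_eq_iff: "L x = L y \<longleftrightarrow> cycle_of \<sigma> x = cycle_of \<sigma> y"
    if "L \<in> labellings D \<sigma> n" "x \<in> D" "y \<in> D" for L x y
    using fiber[of L y] that iff[of x y] by blast
  show ?thesis
  proof (cases "card C = n")
    case True
    define h where "h = (\<lambda>f. \<lambda>x\<in>D. f (cycle_of \<sigma> x) :: nat)"
    have "bij_betw h {f \<in> C \<rightarrow>\<^sub>E {1..n}. inj_on f C} (labellings D \<sigma> n)"
      unfolding bij_betw_def
    proof
      show "inj_on h {f \<in> C \<rightarrow>\<^sub>E {1..n}. inj_on f C}"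
      proof (rule inj_onI)
        fix f g assume f: "f \<in> {f \<in> C \<rightarrow>\<^sub>E {1..n}. inj_on f C}"
          and g: "g \<in> {f \<in> C \<rightarrow>\<^sub>E {1..n}. inj_on f C}" and "h f = h g"
        then have "f (cycle_of \<sigma> x) = g (cycle_of \<sigma> x)" if "x \<in> D" for x
          using that unfolding h_def by (metis restrict_apply')
        then show "f = g"
          using f g by (intro PiE_ext[of f C _ g]) (auto simp: C_def)
      qed
      show "h ` {f \<in> C \<rightarrow>\<^sub>E {1..n}. inj_on f C} = labellings D \<sigma> n"
      proof (intro equalityI subsetI)
        fix L assume "L \<in> h ` {f \<in> C \<rightarrow>\<^sub>E {1..n}. inj_on f C}"
        then obtain f where f: "f \<in> C \<rightarrow>\<^sub>E {1..n}" "inj_on f C" and L: "L = h f"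
          by auto
        have "card (f ` C) = card {1..n}"
          using f(2) True by (simp add: card_image)
        then have img: "f ` C = {1..n}"
          using f(1) by (intro card_subset_eq) auto
        have "\<exists>k\<in>D. {c \<in> D. L c = i} = cycle_of \<sigma> k" if i: "i \<in> {1..n}" for i
        proof -
          obtain k where k: "k \<in> D" "f (cycle_of \<sigma> k) = i"
          proof -
            from i img have "i \<in> f ` C"
              by simp
            then show ?thesis
              using that by (auto simp: C_def)
          qed
          have "L c = i \<longleftrightarrow> c \<in> cycle_of \<sigma> k" if "c \<in> D" for c
            using that k f(2) iff[of c k] by (auto simp: L h_def C_def inj_on_def)
          then show ?thesis
            using k sub by (intro bexI[of _ k]) auto
        qed
        moreover have "L \<in> D \<rightarrow>\<^sub>E {1..n}"
          using f(1) by (auto simp: L h_def C_def)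
        ultimately show "L \<in> labellings D \<sigma> n"
          by (auto simp: labellings_def)
      next
        fix L assume L: "L \<in> labellings D \<sigma> n"
        define f where "f = (\<lambda>c\<in>C. L (SOME x. x \<in> D \<and> cycle_of \<sigma> x = c))"
        have f: "f (cycle_of \<sigma> x) = L x" if x: "x \<in> D" for x
        proof -
          define y where "y = (SOME y. y \<in> D \<and> cycle_of \<sigma> y = cycle_of \<sigma> x)"
          have "y \<in> D \<and> cycle_of \<sigma> y = cycle_of \<sigma> x"
            unfolding y_def by (rule someI[of _ x]) (use x in simp)
          then have "L y = L x"
            using L_eq_iff[OF L] x by blast
          then show ?thesis
            using x by (simp add: f_def C_def y_def)
        qed
        have "f \<in> C \<rightarrow>\<^sub>E {1..n}"
        proof (rule PiE_I)
          show "f c \<in> {1..n}" if "c \<in> C" for c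
            using that f L by (auto simp: C_def labellings_def)
        qed (simp add: f_def)
        moreover have "inj_on f C"
          unfolding inj_on_def C_def by (simp add: f L_eq_iff[OF L])
        moreover have "L = h f"
        proof
          fix x
          have "L \<in> D \<rightarrow>\<^sub>E {1..n}"
            using L by (simp add: labellings_def)
          then show "L x = h f x"
            by (cases "x \<in> D") (simp_all add: h_def f PiE_arb[of L D])
        qed
        ultimately show "L \<in> h ` {f \<in> C \<rightarrow>\<^sub>E {1..n}. inj_on f C}"
          by blast
      qed
    qed
    then have "card (labellings D \<sigma> n) = card {f \<in> C \<rightarrow>\<^sub>E {1..n}. inj_on f C}"
      by (rule bij_betw_same_card[symmetric])
    then show ?thesis
      using True card_inj_on_extensional[of C] fin by (simp add: num_cycles_def C_def)
  next
    case False
    \<comment> \<open>The fibres of any labelling enumerate the cycles without repetition, so other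
      sizes admit none.\<close>
    have "card C = n" if L: "L \<in> labellings D \<sigma> n" for L
    proof -
      have "bij_betw (\<lambda>i. {c \<in> D. L c = i}) {1..n} C"
        unfolding bij_betw_def
      proof
        have ne: "\<exists>x\<in>D. L x = i" if i: "i \<in> {1..n}" for i
        proof -
          obtain k where "{c \<in> D. L c = i} = cycle_of \<sigma> k"
            using L i unfolding labellings_def by blast
          then have "k \<in> {c \<in> D. L c = i}"
            by simp
          then show ?thesis
            by blast
        qed
        then show "inj_on (\<lambda>i. {c \<in> D. L c = i}) {1..n}"
          by (intro inj_onI) blast
        show "(\<lambda>i. {c \<in> D. L c = i}) ` {1..n} = C"
        proof
          show "(\<lambda>i. {c \<in> D. L c = i}) ` {1..n} \<subseteq> C"
            using L by (auto simp: labellings_def C_def)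
          show "C \<subseteq> (\<lambda>i. {c \<in> D. L c = i}) ` {1..n}"
          proof
            fix c assume "c \<in> C"
            then obtain x where x: "x \<in> D" "c = cycle_of \<sigma> x"
              by (auto simp: C_def)
            moreover have "L x \<in> {1..n}"
              using x L by (auto simp: labellings_def)
            ultimately show "c \<in> (\<lambda>i. {c \<in> D. L c = i}) ` {1..n}"
              using fiber[OF L, of x] by blast
          qed
        qed
      qed
      then show ?thesis
        using bij_betw_same_card by fastforce
    qed
    then have "labellings D \<sigma> n = {}"
      using False by blast
    then show ?thesis
      using False by (simp add: num_cycles_def C_def)
  qed
qed

text \<open>Generators, being their own inverses, move points along edges; conversely, every edge of
  a path is realised by its transposition. Hence transitivity means connectedness.\<close>

lemma gen_perms_transpose_iff:
  "(\<exists>p \<in> gen_perms ((\<lambda>(a, b). transpose a b) ` E). p i = j) \<longleftrightarrow> (i, j) \<in> linked E"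
proof
  assume "\<exists>p \<in> gen_perms ((\<lambda>(a, b). transpose a b) ` E). p i = j"
  then obtain p where p: "p \<in> gen_perms ((\<lambda>(a, b). transpose a b) ` E)" and pi: "p i = j"
    by blast
  have step: "(x, transpose a b x) \<in> linked E" if "(a, b) \<in> E" for x a b
    using linked_edge[OF that] by (auto simp: transpose_def intro: linked_sym)
  from p have "(i, p i) \<in> linked E"
  proof induction
    case (gen s p)
    then show ?case
      using step by (auto intro: linked_trans)
  next
    case (gen_inv s p)
    then show ?case
      using step by (auto intro: linked_trans)
  qed simp
  then show "(i, j) \<in> linked E"
    by (simp add: pi)
next
  let ?G = "gen_perms ((\<lambda>(a, b). transpose a b) ` E)"
  assume "(i, j) \<in> linked E"
  then show "\<exists>p \<in> ?G. p i = j"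
    unfolding linked_def
  proof (induction rule: rtrancl_induct)
    case base
    show ?case
      by (intro bexI[of _ id] gen_perms.id_in) simp
  next
    case (step y z)
    then obtain p where p: "p \<in> ?G" "p i = y"
      by blast
    from step(2) obtain a b where "(a, b) \<in> E" "transpose a b y = z"
      by (auto simp: transpose_def)
    then have "transpose a b \<circ> p \<in> ?G" "(transpose a b \<circ> p) i = z"
      using p by (auto intro!: gen_perms.gen)
    then show ?case
      by blast
  qed
qed

text \<open>Isolates the only condition that involves the individual parts of \<open>\<mu>\<close>,
  so that it can be summed out.\<close>

lemma mem_monotone_tuples_iff:
  "(ts, L) \<in> monotone_tuples m \<mu> \<longleftrightarrow>
     ts \<in> conn_lists {1..sum_list \<mu>} m \<and> L \<in> labellings {1..sum_list \<mu>} (tuple_perm ts) (length \<mu>) \<and>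
     (\<forall>i<length \<mu>. card {c \<in> {1..sum_list \<mu>}. L c = Suc i} = \<mu> ! i)"
  (is "?l \<longleftrightarrow> ?r")
proof -
  define d n where "d = sum_list \<mu>" and "n = length \<mu>"
  have range: "(\<forall>(a, b)\<in>set ts. 1 \<le> a \<and> a < b \<and> b \<le> sum_list \<mu>) \<longleftrightarrow>
      (\<forall>(a, b)\<in>set ts. a \<in> {1..sum_list \<mu>} \<and> b \<in> {1..sum_list \<mu>} \<and> a < b)"
    by (intro ball_cong refl) auto
  \<comment> \<open>The length condition moves from the witness \<open>k\<close> to the fibre, which
    no longer mentions it.\<close>
  have aux: "(\<exists>k\<in>D. A = C k \<and> card (C k) = u) \<longleftrightarrow> (\<exists>k\<in>D. A = C k) \<and> card A = u"
    for D :: "nat set" and A :: "nat set" and C u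
    by auto
  have "?l \<longleftrightarrow> ts \<in> conn_lists {1..d} m \<and> L \<in> {1..d} \<rightarrow>\<^sub>E {1..n} \<and>
           (\<forall>i\<in>{1..n}. \<exists>k\<in>{1..d}. {c\<in>{1..d}. L c = i} = cycle_of (tuple_perm ts) k \<and>
                card (cycle_of (tuple_perm ts) k) = \<mu> ! (i - 1))"
    unfolding monotone_tuples_def Let_def gen_perms_transpose_iff conn_lists_def mono_lists_def
      d_def n_def mem_Collect_eq prod.case
    by (simp only: conj_assoc range)
  also have "(\<forall>i\<in>{1..n}. \<exists>k\<in>{1..d}. {c\<in>{1..d}. L c = i} = cycle_of (tuple_perm ts) k \<and>
                card (cycle_of (tuple_perm ts) k) = \<mu> ! (i - 1)) \<longleftrightarrow>
             (\<forall>i\<in>{1..n}. \<exists>k\<in>{1..d}. {c\<in>{1..d}. L c = i} = cycle_of (tuple_perm ts) k) \<and>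
             (\<forall>i\<in>{1..n}. card {c \<in> {1..d}. L c = i} = \<mu> ! (i - 1))"
    unfolding ball_conj_distrib[symmetric] by (intro ball_cong refl aux)
  also have "(\<forall>i\<in>{1..n}. card {c \<in> {1..d}. L c = i} = \<mu> ! (i - 1)) \<longleftrightarrow>
             (\<forall>i<n. card {c \<in> {1..d}. L c = Suc i} = \<mu> ! i)"
    unfolding image_Suc_lessThan[symmetric] by (simp add: ball_simps(9) Ball_def[of "{..<n}"])
  finally show ?thesis
    by (auto simp: labellings_def d_def n_def)
qed

section \<open>Summation over cycle lengths, and the genus of a sequence\<close>

definition compositions :: "nat \<Rightarrow> nat \<Rightarrow> nat list set" where
  "compositions n d = {\<mu>. length \<mu> = n \<and> (\<forall>k\<in>set \<mu>. 1 \<le> k) \<and> sum_list \<mu> = d}"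

lemma finite_compositions: "finite (compositions n d)"
proof (rule finite_subset)
  show "compositions n d \<subseteq> {\<mu>. set \<mu> \<subseteq> {..d} \<and> length \<mu> = n}"
    using member_le_sum_list by (fastforce simp: compositions_def)
qed (rule finite_lists_length_eq, simp)

text \<open>The fibre sizes of a labelling determine \<open>\<mu>\<close>, so the sum over
  compositions counts each labelled sequence once, and each sequence with \<open>n\<close> cycles
  has \<open>fact n\<close> labellings.\<close>

lemma sum_monotone_tuples:
  "(\<Sum>\<mu> \<in> compositions n d. card (monotone_tuples m \<mu>)) =
     fact n * card {ts \<in> conn_lists {1..d} m. num_cycles {1..d} (tuple_perm ts) = n}"
proof -
  define W where "W = (SIGMA ts:conn_lists {1..d} m. labellings {1..d} (tuple_perm ts) n)"
  define sizes where "sizes = (\<lambda>L :: nat \<Rightarrow> nat. map (\<lambda>i. card {c \<in> {1..d}. L c = Suc i}) [0..<n])"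
  have mem: "(ts, L) \<in> monotone_tuples m \<mu> \<longleftrightarrow> (ts, L) \<in> W \<and> sizes L = \<mu>"
    if "\<mu> \<in> compositions n d" for \<mu> ts L
    using that
    by (auto simp: compositions_def mem_monotone_tuples_iff W_def sizes_def list_eq_iff_nth_eq)
  have sizes: "sizes L \<in> compositions n d" if "(ts, L) \<in> W" for ts L
  proof -
    have L: "L \<in> labellings {1..d} (tuple_perm ts) n"
      using that by (simp add: W_def)
    have "card {c \<in> {1..d}. L c = i} \<ge> 1" if i: "i \<in> {1..n}" for i
    proof -
      obtain k where "{c \<in> {1..d}. L c = i} = cycle_of (tuple_perm ts) k"
        using L i unfolding labellings_def by blast
      then have "k \<in> {c \<in> {1..d}. L c = i}"
        by simp
      then have "card {c \<in> {1..d}. L c = i} > 0"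
        by (auto simp: card_gt_0_iff)
      then show ?thesis
        by simp
    qed
    moreover have "sum_list (sizes L) = d"
    proof -
      have "sum_list (sizes L) = (\<Sum>i\<in>{1..n}. card {c \<in> {1..d}. L c = i})"
        unfolding sizes_def interv_sum_list_conv_sum_set_nat image_Suc_lessThan[symmetric]
        by (simp add: sum.reindex atLeast0LessThan)
      also have "\<dots> = card {1..d}"
        using sum.group[of "{1..d}" "{1..n}" L "\<lambda>_. 1 :: nat"] L by (auto simp: labellings_def)
      finally show ?thesis
        by simp
    qed
    ultimately show ?thesis
      by (auto simp: compositions_def sizes_def)
  qed
  have tuples: "monotone_tuples m \<mu> = {w \<in> W. sizes (snd w) = \<mu>}" if "\<mu> \<in> compositions n d" for \<mu>
    using mem[OF that] by auto
  have fin_lab: "finite (labellings {1..d} \<sigma> n)" for \<sigma>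
    by (rule finite_subset[of _ "{1..d} \<rightarrow>\<^sub>E {1..n}"]) (auto simp: labellings_def finite_PiE)
  then have "finite W"
    unfolding W_def by (intro finite_SigmaI finite_conn_lists fin_lab) simp
  moreover have "(\<lambda>w. sizes (snd w)) ` W \<subseteq> compositions n d"
    using sizes by auto
  ultimately have "(\<Sum>\<mu> \<in> compositions n d. card {w \<in> W. sizes (snd w) = \<mu>}) = card W"
    using sum.group[of W "compositions n d" "\<lambda>w. sizes (snd w)" "\<lambda>_. 1 :: nat"]
    by (simp add: finite_compositions)
  then have "(\<Sum>\<mu> \<in> compositions n d. card (monotone_tuples m \<mu>)) = card W"
    using tuples by simp
  also have "\<dots> = (\<Sum>ts\<in>conn_lists {1..d} m. card (labellings {1..d} (tuple_perm ts) n))"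
    unfolding W_def by (intro card_SigmaI ballI finite_conn_lists fin_lab) simp
  also have "\<dots> = (\<Sum>ts\<in>conn_lists {1..d} m. if num_cycles {1..d} (tuple_perm ts) = n then fact n else 0)"
  proof (rule sum.cong)
    fix ts assume "ts \<in> conn_lists {1..d} m"
    then have "set ts \<subseteq> {1..d} \<times> {1..d}"
      by (auto simp: conn_lists_def mono_lists_def)
    then show "card (labellings {1..d} (tuple_perm ts) n) =
                 (if num_cycles {1..d} (tuple_perm ts) = n then fact n else 0)"
      by (intro card_labellings tuple_perm_permutes) auto
  qed simp
  also have "\<dots> = fact n * card {ts \<in> conn_lists {1..d} m. num_cycles {1..d} (tuple_perm ts) = n}"
    by (simp add: sum.If_cases finite_conn_lists Int_def mult.commute)
  finally show ?thesis .
qed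

text \<open>With a single component, the Riemann-Hurwitz bound and parity say that m + 2 - n - d is
  a nonnegative even number; half of it is the genus.\<close>

lemma conn_lists_num_cycles:
  assumes "d > 0" and ts: "ts \<in> conn_lists {1..d} m"
  defines "n \<equiv> num_cycles {1..d} (tuple_perm ts)"
  shows "n \<in> {1..d}" and "\<exists>g. m + 2 = 2 * g + n + d"
proof -
  have "1 \<le> card (cycle_of (tuple_perm ts) ` {1..d})"
    using \<open>d > 0\<close> by (simp add: Suc_le_eq card_gt_0_iff)
  moreover have "card (cycle_of (tuple_perm ts) ` {1..d}) \<le> d"
    using card_image_le[of "{1..d}"] by simp
  ultimately show "n \<in> {1..d}"
    by (simp add: n_def num_cycles_def)
  have "component (set ts) x = component (set ts) 1" if "x \<in> {1..d}" for x
    using that ts by (auto simp: component_eq_iff conn_lists_def)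
  then have "component (set ts) ` {1..d} = (\<lambda>_. component (set ts) 1) ` {1..d}"
    by (intro image_cong refl)
  then have one: "card (component (set ts) ` {1..d}) = 1"
    using \<open>d > 0\<close> by (simp add: image_constant_conv)
  have "\<forall>(a, b)\<in>set ts. a \<in> {1..d} \<and> b \<in> {1..d} \<and> a \<noteq> b" and "length ts = m"
    using ts by (auto simp: conn_lists_def mono_lists_def)
  with riemann_hurwitz[of "{1..d}" ts] one have "n + d \<le> m + 2" "even (n + d + m)"
    by (auto simp: n_def)
  then have "even (m + 2 - (n + d))"
    by simp
  then obtain g where "m + 2 - (n + d) = 2 * g"
    by (rule evenE)
  with \<open>n + d \<le> m + 2\<close> have "m + 2 = 2 * g + n + d"
    by simp
  then show "\<exists>g. m + 2 = 2 * g + n + d" ..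
qed

text \<open>Connecting \<open>d\<close> points takes at least \<open>d - 1\<close> transpositions.
  This is what makes \<open>conn_fps d\<close> divisible by \<open>fps_X ^ (d - 1)\<close>.\<close>

lemma conn_count_eq_0:
  assumes "d > 0" and "Suc m < d"
  shows "conn_count d m = 0"
proof -
  have False if ts: "ts \<in> conn_lists {1..d} m" for ts
    using conn_lists_num_cycles[OF assms(1) ts] assms(2) by auto
  then have "conn_lists {1..d} m = {}"
    by blast
  then show ?thesis
    by (simp add: conn_count_def)
qed

lemma free_energy_diag_coeff_eq:
  assumes "n > 0" and "d > 0"
  shows "free_energy_diag_coeff g n d = of_nat (fact n * card {ts \<in> conn_lists {1..d} (2 * g + n + d - 2).
           num_cycles {1..d} (tuple_perm ts) = n}) / fact d"
proof -
  \<comment> \<open>As \<open>n\<close> and \<open>d\<close> are positive, the subtraction is exact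
    and the cutoff for negative \<open>m\<close> never applies.\<close>
  define m where "m = 2 * g + n + d - 2"
  have "monotone_hurwitz g \<mu> = of_nat (card (monotone_tuples m \<mu>)) / fact d"
    if "\<mu> \<in> compositions n d" for \<mu>
  proof -
    have "2 * int g - 2 + int (length \<mu>) + int (sum_list \<mu>) = int m"
      using that assms by (auto simp: compositions_def m_def)
    then show ?thesis
      using that by (simp add: monotone_hurwitz_def compositions_def)
  qed
  then have "free_energy_diag_coeff g n d =
               of_nat (\<Sum>\<mu>\<in>compositions n d. card (monotone_tuples m \<mu>)) / fact d"
    unfolding free_energy_diag_coeff_def compositions_def[symmetric] of_nat_sum sum_divide_distrib
    by (rule sum.cong[OF refl])
  then show ?thesis
    by (simp only: sum_monotone_tuples m_def)
qed

text \<open>With j = 2g + n - 1 the number of transpositions is j + d - 1, whatever the pair (g, n);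
  the sum over pairs thus sorts the connected sequences of this length by their number of
  cycles.\<close>

lemma exponent_coeff_shifted_eq:
  assumes "d > 0"
  shows "exponent_coeff_shifted d = Abs_fps (\<lambda>j. of_nat (conn_count d (j + d - 1)) / fact d)"
proof (rule fps_ext)
  fix j
  define m where "m = j + d - 1"
  define K where "K = (\<lambda>n. {ts \<in> conn_lists {1..d} m. num_cycles {1..d} (tuple_perm ts) = n})"
  \<comment> \<open>For given \<open>n\<close> and \<open>j\<close> at most one \<open>g\<close>
    fits. If none does, the genus relation shows that no sequence has \<open>n\<close>
    cycles.\<close>
  have inner: "(\<Sum>g\<in>{g. 2 * g + n - 1 = j}. free_energy_diag_coeff g n d / of_nat (fact n)) =
                 of_nat (card (K n)) / fact d" if n: "n \<in> {1..d}" for n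
  proof (cases "\<exists>g. 2 * g + n - 1 = j")
    case True
    then obtain g where g: "2 * g + n - 1 = j"
      by blast
    then have "{g. 2 * g + n - 1 = j} = {g}"
      using n by auto
    moreover have "2 * g + n + d - 2 = m"
      using g n by (auto simp: m_def)
    ultimately show ?thesis
      using n assms by (simp add: free_energy_diag_coeff_eq K_def)
  next
    case False
    have "K n = {}"
    proof (rule ccontr)
      assume "K n \<noteq> {}"
      then obtain g where "m + 2 = 2 * g + n + d"
        using conn_lists_num_cycles(2)[OF assms, of _ m] unfolding K_def by blast
      then have "2 * g + n - 1 = j"
        using assms n by (auto simp: m_def)
      with False show False
        by blast
    qed
    moreover have "{g. 2 * g + n - 1 = j} = {}"
      using False by blast
    ultimately show ?thesis
      by simp
  qed
  have "(\<Sum>n\<in>{1..d}. card (K n)) = card (\<Union>n\<in>{1..d}. K n)"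
    by (subst card_UN_disjoint) (auto simp: K_def finite_conn_lists)
  also have "(\<Union>n\<in>{1..d}. K n) = conn_lists {1..d} m"
    using conn_lists_num_cycles(1)[OF assms, of _ m] unfolding K_def by blast
  finally have "(\<Sum>n\<in>{1..d}. card (K n)) = conn_count d m"
    by (simp add: conn_count_def)
  then show "exponent_coeff_shifted d $ j = Abs_fps (\<lambda>j. of_nat (conn_count d (j + d - 1)) / fact d) $ j"
    using inner
    by (simp add: exponent_coeff_shifted_def m_def flip: sum_divide_distrib of_nat_sum)
qed

subsection \<open>Generating functions\<close>

definition mono_fps :: "nat \<Rightarrow> rat fps" where
  "mono_fps d = Abs_fps (\<lambda>m. of_nat (mono_count d m))"

definition conn_fps :: "nat \<Rightarrow> rat fps" where
  "conn_fps d = Abs_fps (\<lambda>m. of_nat (conn_count d m))"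

lemma fps_of_nat_mult_nth: "(of_nat c * f) $ n = of_nat c * f $ n" for f :: "rat fps"
  by (simp flip: fps_of_nat)

text \<open>Equivalently, multiplying the series for \<open>Suc d\<close> by 1 - d hbar gives the
  series for \<open>d\<close>.\<close>

lemma mono_fps_Suc:
  "mono_fps (Suc d) = mono_fps d + fps_X * (of_nat d * mono_fps (Suc d))"
proof (rule fps_ext)
  fix m
  show "mono_fps (Suc d) $ m = (mono_fps d + fps_X * (of_nat d * mono_fps (Suc d))) $ m"
    by (cases m)
       (simp_all add: mono_fps_def mono_count_Suc_Suc fps_of_nat_mult_nth)
qed

lemma mono_fps_Suc_conv_conn_fps:
  "mono_fps (Suc d) = (\<Sum>k\<le>d. of_nat (d choose k) * (conn_fps (Suc k) * mono_fps (d - k)))"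
proof (rule fps_ext)
  fix m
  have "(\<Sum>k\<le>d. of_nat (d choose k) * (conn_fps (Suc k) * mono_fps (d - k))) $ m =
          (\<Sum>k\<le>d. of_nat (d choose k) * (conn_fps (Suc k) * mono_fps (d - k)) $ m)"
    by (simp only: fps_sum_nth fps_of_nat_mult_nth)
  then show "mono_fps (Suc d) $ m =
          (\<Sum>k\<le>d. of_nat (d choose k) * (conn_fps (Suc k) * mono_fps (d - k))) $ m"
    by (simp add: mono_fps_def conn_fps_def mono_count_Suc[of d m] fps_mult_nth atLeast0AtMost)
qed

lemma fps_to_fls_sum: "fps_to_fls (\<Sum>x\<in>A. f x) = (\<Sum>x\<in>A. fps_to_fls (f x))"
  by (induction A rule: infinite_finite_induct) (simp_all)

lemma mono_fps_0: "mono_fps 0 = 1"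
proof (rule fps_ext)
  fix m show "mono_fps 0 $ m = 1 $ m"
    by (cases m) (simp_all add: mono_fps_def)
qed

text \<open>The shift by \<open>d - 1\<close> loses nothing because the lower coefficients of
  \<open>conn_fps d\<close> vanish.\<close>

lemma exponent_coeff_shifted_conv_conn_fps:
  assumes "d > 0"
  shows "conn_fps d = of_nat (fact d) * (fps_X ^ (d - 1) * exponent_coeff_shifted d)"
proof (rule fps_ext)
  fix m
  show "conn_fps d $ m = (of_nat (fact d) * (fps_X ^ (d - 1) * exponent_coeff_shifted d)) $ m"
    using assms conn_count_eq_0[OF assms, of m]
    by (auto simp: conn_fps_def exponent_coeff_shifted_eq fps_X_power_mult_nth
          fps_of_nat_mult_nth[of "fact d", simplified])
qed

section \<open>Exponent and partition function in terms of the counts\<close>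

lemma free_energy_sum_nth_0: "free_energy_sum $ 0 = 0"
proof -
  have "exponent_coeff_shifted 0 = 0"
    by (rule fps_ext) (simp add: exponent_coeff_shifted_def)
  then show ?thesis
    by (simp add: free_energy_sum_def)
qed

text \<open>The shift by \<open>k\<close> and the factor \<open>fls_X_inv\<close> combine to
  hbar^-(k+1), one factor 1 / hbar per point.\<close>

lemma free_energy_sum_nth_Suc:
  "free_energy_sum $ Suc k = fps_to_fls (conn_fps (Suc k)) / (fls_X ^ Suc k * fact (Suc k))"
proof -
  define X E where "X = (fls_X :: rat fls)" and "E = fps_to_fls (exponent_coeff_shifted (Suc k))"
  have X: "X \<noteq> 0" "fls_X_inv = inverse X"
    by (simp_all only: X_def fls_inverse_X fls_X_nonzero not_False_eq_True)
  have "fps_to_fls (conn_fps (Suc k)) = fact (Suc k) * (X ^ k * E)"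
    unfolding exponent_coeff_shifted_conv_conn_fps[OF zero_less_Suc] X_def E_def
    by (simp only: fls_times_fps_to_fls fps_to_fls_power fps_to_fls_of_nat fps_X_to_fls diff_Suc_1)
       (simp only: of_nat_fact)
  then have "inverse X * E = fps_to_fls (conn_fps (Suc k)) / (X ^ Suc k * fact (Suc k))"
    using X(1) by (simp add: field_simps del: fact_Suc)
  then show ?thesis
    by (simp only: free_energy_sum_def fps_nth_Abs_fps X(2) E_def X_def)
qed

text \<open>The equation expresses \<open>Suc m\<close> times the next coefficient through earlier
  ones, and \<open>Suc m\<close> is invertible in characteristic 0.\<close>

lemma fps_linear_ode_unique:
  fixes Y Z F :: "'a::field_char_0 fps"
  assumes "fps_deriv Y = F * Y" and "fps_deriv Z = F * Z" and "Y $ 0 = Z $ 0"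
  shows "Y = Z"
proof (rule fps_ext)
  fix n
  show "Y $ n = Z $ n"
  proof (induction n rule: less_induct)
    case (less n)
    show ?case
    proof (cases n)
      case (Suc m)
      have "of_nat (Suc m) * Y $ Suc m = fps_deriv Y $ m"
        by (simp only: fps_deriv_nth Suc_eq_plus1)
      also have "\<dots> = (\<Sum>i=0..m. F $ i * Y $ (m - i))"
        by (simp only: assms fps_mult_nth)
      also have "\<dots> = (\<Sum>i=0..m. F $ i * Z $ (m - i))"
        using less Suc by (intro sum.cong) auto
      also have "\<dots> = fps_deriv Z $ m"
        by (simp only: assms fps_mult_nth)
      also have "\<dots> = of_nat (Suc m) * Z $ Suc m"
        by (simp only: fps_deriv_nth Suc_eq_plus1)
      finally show ?thesis
        unfolding Suc by (simp del: of_nat_Suc)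
    qed (use assms in simp)
  qed
qed

text \<open>Both sides have constant term 1 and solve \<open>Y' = F' Y\<close>: the exponential by
  the chain rule, the explicit series by the component identity.\<close>

lemma partition_function_eq:
  "partition_function = Abs_fps (\<lambda>d. fps_to_fls (mono_fps d) / (fls_X ^ d * fact d))"
proof (rule fps_linear_ode_unique[where F = "fps_deriv free_energy_sum"])
  show "fps_deriv partition_function = fps_deriv free_energy_sum * partition_function"
    by (simp add: partition_function_def fps_compose_deriv free_energy_sum_nth_0 mult.commute)
  show "partition_function $ 0 = Abs_fps (\<lambda>d. fps_to_fls (mono_fps d) / (fls_X ^ d * fact d)) $ 0"
    by (simp add: partition_function_def mono_fps_0)
  define Z where "Z = Abs_fps (\<lambda>d. fps_to_fls (mono_fps d) / (fls_X ^ d * fact d))"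
  define X where "X = (fls_X :: rat fls)"
  define H where "H = (\<lambda>d. fps_to_fls (mono_fps d))"
  define K where "K = (\<lambda>d. fps_to_fls (conn_fps d))"
  have Z: "Z $ d = H d / (X ^ d * fact d)" for d
    by (simp only: Z_def X_def H_def fps_nth_Abs_fps)
  have F: "free_energy_sum $ Suc k = K (Suc k) / (X ^ Suc k * fact (Suc k))" for k
    by (simp only: free_energy_sum_nth_Suc X_def K_def)
  have H: "H (Suc n) = (\<Sum>k\<le>n. of_nat (n choose k) * (K (Suc k) * H (n - k)))" for n
    by (simp add: H_def K_def mono_fps_Suc_conv_conn_fps fps_to_fls_sum fls_times_fps_to_fls)
  have cancel: "of_nat (Suc n) * (a / (b * fact (Suc n))) = a / (b * fact n)" for n and a b :: "rat fls"
    by (simp add: fact_Suc del: of_nat_Suc)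
  have "fps_deriv Z = fps_deriv free_energy_sum * Z"
  proof (rule fps_ext)
    fix n
    have "fps_deriv Z $ n = H (Suc n) / (X ^ Suc n * fact n)"
      by (simp only: fps_deriv_nth Z cancel Suc_eq_plus1[symmetric])
    also have "\<dots> = (\<Sum>k\<le>n. of_nat (n choose k) * (K (Suc k) * H (n - k)) / (X ^ Suc n * fact n))"
      by (simp only: H sum_divide_distrib)
    also have "\<dots> = (\<Sum>k\<le>n. fps_deriv free_energy_sum $ k * Z $ (n - k))"
    proof (rule sum.cong)
      fix k assume "k \<in> {..n}"
      then have k: "k \<le> n"
        by simp
      \<comment> \<open>The weight 1 / hbar per point is multiplicative over the block of
        \<open>k + 1\<close> points and its complement.\<close>
      have "X ^ Suc n = X ^ Suc k * X ^ (n - k)"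
        using k by (simp flip: power_add power_Suc)
      moreover have "of_nat (n choose k) = (fact n / (fact k * fact (n - k)) :: rat fls)"
        using k by (rule binomial_fact)
      moreover have "fps_deriv free_energy_sum $ k = K (Suc k) / (X ^ Suc k * fact k)"
        by (simp only: fps_deriv_nth F cancel Suc_eq_plus1[symmetric])
      ultimately show "of_nat (n choose k) * (K (Suc k) * H (n - k)) / (X ^ Suc n * fact n) =
                         fps_deriv free_energy_sum $ k * Z $ (n - k)"
        by (simp add: Z mult_ac del: power_Suc fps_deriv_nth)
    qed simp
    also have "\<dots> = (fps_deriv free_energy_sum * Z) $ n"
      by (simp add: fps_mult_nth atLeast0AtMost)
    finally show "fps_deriv Z $ n = (fps_deriv free_energy_sum * Z) $ n" .
  qed
  then show "fps_deriv (Abs_fps (\<lambda>d. fps_to_fls (mono_fps d) / (fls_X ^ d * fact d))) =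
        fps_deriv free_energy_sum * Abs_fps (\<lambda>d. fps_to_fls (mono_fps d) / (fls_X ^ d * fact d))"
    by (simp only: Z_def)
qed

lemma fps_diff_operator_nth:
  fixes A B C :: "'a::comm_ring_1 fps"
  shows "(fps_X * fps_const a * A - fps_const b * B + C) $ n = a * (fps_X * A) $ n - b * B $ n + C $ n"
proof -
  have "fps_X * fps_const a * A = fps_const a * (fps_X * A)"
    by (simp only: mult_ac)
  then show ?thesis
    by (simp only: fps_add_nth fps_sub_nth fps_mult_left_const_nth)
qed

theorem theorem2:
  "fps_X * fps_const (fls_X ^ 2) * fps_deriv (fps_deriv partition_function)
     - fps_const fls_X * fps_deriv partition_function + partition_function = (0 :: rat fls fps)"
proof (rule fps_ext)
  fix n
  define X where "X = (fls_X :: rat fls)"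
  have "X \<noteq> 0"
    by (simp add: X_def)
  define H where "H = (\<lambda>d. fps_to_fls (mono_fps d))"
  have coeff: "partition_function $ d = H d / (X ^ d * fact d)" for d
    by (simp only: partition_function_eq H_def X_def fps_nth_Abs_fps)
  have deriv: "fps_deriv partition_function $ n = H (Suc n) / (X ^ Suc n * fact n)"
    by (simp add: coeff fact_Suc del: of_nat_Suc power_Suc)
  have rec: "H (Suc n) = H n + X * (of_nat n * H (Suc n))"
    unfolding H_def X_def by (subst mono_fps_Suc) (simp add: fls_times_fps_to_fls)
  \<comment> \<open>Multiplying by \<open>x\<close> restores the degree lost in the second
    derivative; at \<open>n = 0\<close> both sides vanish.\<close>
  have second: "(fps_X * fps_deriv (fps_deriv partition_function)) $ n =
                  of_nat n * fps_deriv partition_function $ n"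
    by (cases n) simp_all
  define P where "P = X ^ n * fact n"
  have P: "X ^ Suc n * fact n = X * P"
    by (simp add: P_def)
  have "(fps_X * fps_const (X ^ 2) * fps_deriv (fps_deriv partition_function)
     - fps_const X * fps_deriv partition_function + partition_function) $ n =
     X ^ 2 * (fps_X * fps_deriv (fps_deriv partition_function)) $ n
     - X * fps_deriv partition_function $ n + partition_function $ n"
    by (rule fps_diff_operator_nth)
  \<comment> \<open>Over the common denominator \<open>P\<close>, the numerator is exactly the
    defect in the recursion \<open>rec\<close>.\<close>
  also have "\<dots> = (X * (of_nat n * H (Suc n)) - H (Suc n) + H n) / P"
    unfolding second deriv coeff[of n] P P_def[symmetric] using \<open>X \<noteq> 0\<close>
    by (simp add: power2_eq_square add_divide_distrib diff_divide_distrib)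
  also have "\<dots> = 0"
    proof -
    have "X * (of_nat n * H (Suc n)) - H (Suc n) + H n = 0"
      using rec by algebra
    then show ?thesis
      by (simp only: div_0)
  qed
  finally show "(fps_X * fps_const (fls_X ^ 2) * fps_deriv (fps_deriv partition_function)
     - fps_const fls_X * fps_deriv partition_function + partition_function) $ n = (0 :: rat fls fps) $ n"
    by (simp only: X_def fps_zero_nth)
qed

end
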